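(* Let $f \in \mathbb{Z}[x]$ be a polynomial of degree $d$, and let $n$ be any integer with $n > L(f')$, where $f'$ is the derivative of $f$. Then there is a square-free polynomial $g \in \mathbb{Z}[x]$ with $\deg g = n$ such that $L(f-g) = 1$ if $x^2 \nmid f(x)$, and $L(f-g) = 2$ if $x^2 \mid f(x)$. (In particular, in all cases there is such a square-free $g$ of degree $n$ with $L(f-g)\le 2$.)
   Context: For $h(x) = a_n x^n + \cdots + a_0 \in \mathbb{Z}[x]$, its length is $L(h) = |a_n| + |a_{n-1}| + \cdots + |a_0|$ (with $L(0)=0$). A polynomial $g \in \mathbb{Z}[x]$ is called square-free if there is no polynomial $h \in \mathbb{Z}[x]$ of degree at least $1$ such that $h^2$ divides $g$. *)

theory Defs
  imports "HOL-Computational_Algebra.Polynomial"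
begin

definition poly_length :: "int poly \<Rightarrow> int" where
  "poly_length h = (\<Sum>i\<le>degree h. \<bar>coeff h i\<bar>)"

text \<open>
  Only square factors of positive degree are excluded, so \<open>[:4:]\<close> is square-free here,
  although it is not \<open>squarefree\<close> in the sense of the library (which excludes the square
  of every non-unit of the ring of integer polynomials).
\<close>
definition square_free_poly :: "int poly \<Rightarrow> bool" where
  "square_free_poly g \<longleftrightarrow> \<not> (\<exists>h :: int poly. degree h \<ge> 1 \<and> h ^ 2 dvd g)"

end

(* With N > L(f'), the derivative N x^(N-1) + f' of g = x^N + f + c has all its complex roots in
   the open unit disk, the leading term being dominant outside it. If h^2 divides g, then h
   divides g' and has leading coefficient 1 or -1, so the integer h(0) is, up to sign, the product
   of the roots of h and therefore vanishes. Hence x divides h and x^2 divides f + c; taking c = 0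
   if x^2 does not divide f, and c = 1 otherwise, excludes this. *)
theory Submission
  imports Defs "HOL-Computational_Algebra.Fundamental_Theorem_Algebra"
begin

lemma map_poly_of_int_mult:
  "map_poly (of_int :: int \<Rightarrow> 'a::comm_ring_1) (p * q) = map_poly of_int p * map_poly of_int q"
  by (intro poly_eqI) (simp add: coeff_map_poly coeff_mult)

lemma map_poly_of_int_add:
  "map_poly (of_int :: int \<Rightarrow> 'a::comm_ring_1) (p + q) = map_poly of_int p + map_poly of_int q"
  by (intro poly_eqI) (simp add: coeff_map_poly)

text \<open>Over the complex numbers \<open>p\<close> splits into linear factors, so its value at 0
  is, up to sign, the leading coefficient times the product of the roots, all of modulus below
  1.\<close>

lemma norm_poly_0_less_norm_lead_coeff:
  fixes p :: "complex poly"
  assumes "degree p \<ge> 1" and roots: "\<And>z. poly p z = 0 \<Longrightarrow> norm z < 1"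
  shows "norm (poly p 0) < norm (lead_coeff p)"
proof -
  obtain root where root: "smult (lead_coeff p) (\<Prod>i<degree p. [:-root i, 1:]) = p"
    by (rule complex_poly_decompose')
  have eval: "poly p z = lead_coeff p * (\<Prod>i<degree p. z - root i)" for z
    by (subst root[symmetric]) (simp add: poly_prod)
  have "norm (root i) < 1" if "i < degree p" for i
    using that by (intro roots) (auto simp: eval)
  \<comment> \<open>Strictness needs a nonempty product: index 0 is in range because the degree is
    positive.\<close>
  then have "(\<Prod>i<degree p. norm (root i)) < (\<Prod>i<degree p. 1)"
    using assms(1) by (intro prod_mono_strict[of 0]) (auto intro: less_imp_le)
  moreover have "lead_coeff p \<noteq> 0"
    using assms(1) by auto
  ultimately show ?thesis
    by (simp add: eval norm_mult prod_norm[symmetric])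
qed

lemma poly_length_eq_sum:
  assumes "degree p \<le> m"
  shows "poly_length p = (\<Sum>i\<le>m. \<bar>coeff p i\<bar>)"
  unfolding poly_length_def
  using assms by (intro sum.mono_neutral_left) (auto simp: coeff_eq_0)

lemma poly_length_nonneg: "poly_length p \<ge> 0"
  by (simp add: poly_length_def sum_nonneg)

lemma abs_coeff_le_poly_length: "\<bar>coeff p i\<bar> \<le> poly_length p"
proof (cases "i \<le> degree p")
  case True
  then show ?thesis
    unfolding poly_length_def by (intro member_le_sum) auto
qed (simp add: coeff_eq_0 poly_length_nonneg)

text \<open>Outside the open unit disk \<open>norm z ^ m\<close> bounds every lower power of
  \<open>norm z\<close>, so the triangle inequality leaves only the sum of the absolute
  coefficients.\<close>

lemma norm_poly_le_poly_length:
  fixes z :: complex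
  assumes "norm z \<ge> 1" and "degree p \<le> m"
  shows "norm (poly (map_poly of_int p) z) \<le> of_int (poly_length p) * norm z ^ m"
proof -
  have "norm (poly (map_poly of_int p) z) = norm (\<Sum>i\<le>degree p. of_int (coeff p i) * z ^ i)"
    by (simp add: poly_altdef coeff_map_poly degree_map_poly)
  also have "\<dots> \<le> (\<Sum>i\<le>degree p. \<bar>of_int (coeff p i)\<bar> * norm z ^ m)"
    using assms
    by (intro sum_norm_le) (auto simp: norm_mult norm_power intro!: mult_left_mono power_increasing)
  also have "\<dots> = of_int (poly_length p) * norm z ^ m"
    by (simp add: poly_length_def sum_distrib_right)
  finally show ?thesis .
qed

text \<open>The top coefficient of the derivative is the degree times a nonzero integer. Hence an
  exponent exceeding the length of \<open>pderiv f\<close> also exceeds the degree of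
  \<open>f\<close>.\<close>

lemma degree_le_poly_length_pderiv: "int (degree f) \<le> poly_length (pderiv f)"
proof (cases "degree f")
  case (Suc k)
  then have "f \<noteq> 0"
    by auto
  then have "lead_coeff f \<noteq> 0"
    by simp
  then have "1 \<le> \<bar>lead_coeff f\<bar>"
    by linarith
  then have "int (degree f) * 1 \<le> int (degree f) * \<bar>lead_coeff f\<bar>"
    by (intro mult_left_mono) auto
  also have "\<dots> = \<bar>coeff (pderiv f) k\<bar>"
    unfolding Suc coeff_pderiv abs_mult by simp
  finally have "int (degree f) \<le> \<bar>coeff (pderiv f) k\<bar>"
    by simp
  with abs_coeff_le_poly_length[of "pderiv f" k] show ?thesis
    by linarith
qed (simp add: poly_length_nonneg)

text \<open>At a root with \<open>norm z \<ge> 1\<close> the terms \<open>n * z ^ (n - 1)\<close>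
  and \<open>pderiv f\<close> would cancel, although the second is strictly smaller in
  modulus.\<close>

lemma norm_root_less_1:
  fixes z :: complex
  assumes "int n > poly_length (pderiv f)"
    and root: "poly (map_poly of_int (pderiv (monom 1 n + f))) z = 0"
  shows "norm z < 1"
proof (rule ccontr)
  assume "\<not> norm z < 1"
  then have z: "norm z \<ge> 1"
    by simp
  have "degree f < n"
    using degree_le_poly_length_pderiv[of f] assms(1) by linarith
  then have "norm (poly (map_poly of_int (pderiv f)) z)
      \<le> of_int (poly_length (pderiv f)) * norm z ^ (n - 1)"
    by (intro norm_poly_le_poly_length z) (simp add: degree_pderiv)
  also have "\<dots> < of_int (int n) * norm z ^ (n - 1)"
    using z assms(1) by (intro mult_strict_right_mono zero_less_power) (auto simp only: of_int_less_iff)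
  also have "\<dots> = norm (of_nat n * z ^ (n - 1))"
    by (simp add: norm_mult norm_power)
  also have "\<dots> = norm (poly (map_poly of_int (pderiv f)) z)"
  proof -
    have "of_nat n * z ^ (n - 1) + poly (map_poly of_int (pderiv f)) z = 0"
      using root
      by (simp add: pderiv_add pderiv_monom map_poly_of_int_add map_poly_monom poly_monom)
    then show ?thesis
      by (metis add_eq_0_iff norm_minus_cancel)
  qed
  finally show False
    by simp
qed

lemma degree_monom_add:
  assumes "int n > poly_length (pderiv f)"
  shows "degree (monom 1 n + f) = n" and "lead_coeff (monom 1 n + f) = 1"
proof -
  have "degree f < n"
    using degree_le_poly_length_pderiv[of f] assms by linarith
  then show "degree (monom 1 n + f) = n"
    by (simp add: degree_add_eq_left degree_monom_eq)
  with \<open>degree f < n\<close> show "lead_coeff (monom 1 n + f) = 1"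
    by (simp add: coeff_eq_0)
qed

lemma square_free_poly_monom_add:
  assumes n: "int n > poly_length (pderiv f)" and f: "\<not> [:0, 1:] ^ 2 dvd f"
  shows "square_free_poly (monom 1 n + f)"
  unfolding square_free_poly_def
proof
  let ?g = "monom 1 n + f"
  assume "\<exists>h. degree h \<ge> 1 \<and> h ^ 2 dvd ?g"
  then obtain h k where h: "degree h \<ge> 1" and g: "?g = h ^ 2 * k"
    by (auto simp: dvd_def)
  \<comment> \<open>The square of this integer divides the leading coefficient 1 of
    \<open>?g\<close>.\<close>
  have "lead_coeff h dvd 1"
    using degree_monom_add(2)[OF n] unfolding g lead_coeff_mult lead_coeff_power
    by (metis dvd_triv_left dvd_mult_left power2_eq_square)
  then have lead: "\<bar>lead_coeff h\<bar> = 1"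
    by simp
  have "h dvd pderiv ?g"
    unfolding g by (simp add: pderiv_mult power2_eq_square)
  then obtain q where q: "pderiv ?g = h * q"
    by (rule dvdE)
  have "norm z < 1" if "poly (map_poly of_int h) z = (0 :: complex)" for z
    using that n by (intro norm_root_less_1[of f n]) (simp_all add: q map_poly_of_int_mult)
  then have "norm (poly (map_poly of_int h) 0 :: complex) < 1"
    using norm_poly_0_less_norm_lead_coeff[of "map_poly of_int h"] h lead
    by (simp add: degree_map_poly coeff_map_poly)
  \<comment> \<open>An integer of absolute value below 1 is 0.\<close>
  then have "poly h 0 = 0"
    by (simp add: poly_0_coeff_0 coeff_map_poly)
  then have "[:0, 1:] dvd h"
    by (simp add: poly_eq_0_iff_dvd)
  then have dvd_g: "[:0, 1:] ^ 2 dvd ?g"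
    unfolding g by (intro dvd_mult2 dvd_power_same)
  \<comment> \<open>To pass from \<open>?g\<close> to \<open>f\<close>, the square of
    \<open>x\<close> must divide \<open>monom 1 n\<close>, that is, \<open>2 \<le> n\<close>; this
    follows by comparing degrees, as \<open>?g\<close> is nonzero of degree
    \<open>n\<close>.\<close>
  have "?g \<noteq> 0"
    using degree_monom_add(2)[OF n] by (intro notI) (simp only: coeff_0 zero_neq_one)
  with dvd_g have "2 \<le> n"
    using dvd_imp_degree_le[of "[:0, 1:] ^ 2" ?g] degree_monom_add(1)[OF n]
    by (simp add: degree_power_eq)
  then have "[:0, 1:] ^ 2 dvd (monom 1 n :: int poly)"
    by (simp add: monom_altdef le_imp_power_dvd)
  with dvd_g f show False
    by (simp add: dvd_add_right_iff)
qed

theorem theorem1p4: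
  fixes f :: "int poly" and d :: nat and n :: int
  assumes "degree f = d"
    and "n > poly_length (pderiv f)"
  shows "(\<exists>g :: int poly. square_free_poly g \<and> int (degree g) = n \<and>
            (\<not> [:0, 1:] ^ 2 dvd f \<longrightarrow> poly_length (f - g) = 1) \<and>
            ([:0, 1:] ^ 2 dvd f \<longrightarrow> poly_length (f - g) = 2)) \<and>
         (\<exists>g :: int poly. square_free_poly g \<and> int (degree g) = n \<and> poly_length (f - g) \<le> 2)"
proof -
  define N where "N = nat n"
  have "n > 0"
    using poly_length_nonneg[of "pderiv f"] assms(2) by linarith
  then have N: "N > 0" "int N = n"
    by (simp_all add: N_def)
  define c :: int where "c = (if [:0, 1:] ^ 2 dvd f then 1 else 0)"
  define g where "g = monom 1 N + (f + [:c:])"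
  \<comment> \<open>The constant \<open>c\<close> disappears on differentiation, so the bound for
    \<open>f\<close> carries over.\<close>
  have len: "int N > poly_length (pderiv (f + [:c:]))"
    using assms(2) N by (simp add: pderiv_add pderiv_pCons)
  \<comment> \<open>If the square of \<open>x\<close> divided both \<open>f\<close> and
    \<open>f + 1\<close>, it would divide their difference 1.\<close>
  have "\<not> [:0, 1:] ^ 2 dvd [:1 :: int:]"
    using dvd_imp_degree_le[of "[:0, 1:] ^ 2" "[:1 :: int:]"] by (auto simp: degree_power_eq)
  then have "\<not> [:0, 1:] ^ 2 dvd f + [:c:]"
    by (simp add: c_def dvd_add_right_iff)
  with len have sf: "square_free_poly g"
    unfolding g_def by (rule square_free_poly_monom_add)
  have deg: "int (degree g) = n"
    using degree_monom_add(1)[OF len] N by (simp add: g_def)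
  have "f - g = - (monom 1 N + [:c:])"
    by (simp add: g_def)
  moreover have "degree (- (monom 1 N + [:c:])) \<le> N"
    unfolding degree_minus by (intro degree_add_le degree_monom_le) simp
  ultimately have "poly_length (f - g) = (\<Sum>i\<le>N. \<bar>coeff (monom 1 N + [:c:]) i\<bar>)"
    by (simp only: poly_length_eq_sum[of _ N] coeff_minus abs_minus_cancel)
  also have "\<dots> = (\<Sum>i\<in>{0, N}. \<bar>coeff (monom 1 N + [:c:]) i\<bar>)"
    by (intro sum.mono_neutral_right) (auto simp: coeff_pCons split: nat.split)
  \<comment> \<open>Since \<open>N > 0\<close>, the positions 0 and \<open>N\<close> are distinct
    and contribute \<open>\<bar>c\<bar>\<close> and 1 separately.\<close>
  also have "\<dots> = 1 + \<bar>c\<bar>"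
    using N by (simp add: coeff_pCons split: nat.split)
  finally show ?thesis
    using sf deg by (auto simp: c_def split: if_splits)
qed

end
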